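(* Let $N\ge1$ be an integer. For complex $s$ with $0<\Re(s)<N$, $$\int_{0}^{\infty}\{y\}^N y^{-s-1}\,dy=N!\sum_{k=0}^{N-1}\frac{(-1)^k\,\zeta(s-k)}{(N-k)!\,(-s)_{k+1}}.$$
   Context: For real $y$, $\{y\}=y-[y]$ denotes the fractional part of $y$, where $[y]$ is the integer part (floor) of $y$. $\zeta$ denotes the Riemann zeta function (analytically continued to $\mathbb{C}\setminus\{1\}$). The Pochhammer symbol is $(s)_k=\Gamma(s+k)/\Gamma(s)$, so $(-s)_{k+1}=(-s)(1-s)\cdots(k-s)$.
   Formalization: At s = 1, …, N−1, where individual terms on the right are undefined (ζ(1), or a zero of (−s)_{k+1}), the right-hand side is read as its limit, which is proved to exist and equal the integral; at every other s of the strip the identity is literal, and absolute convergence is also shown. *)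

theory Defs
  imports "HOL-Complex_Analysis.Complex_Analysis"
begin

text \<open>
  The Riemann zeta function as the analytic continuation of its Dirichlet series to the plane
  without the point 1. Prescribing the (meaningless) value 0 at the pole makes the
  continuation unique as a total function.
\<close>

definition zeta :: "complex \<Rightarrow> complex" where
  "zeta = (THE f. f holomorphic_on - {1} \<and>
                  (\<forall>s. Re s > 1 \<longrightarrow> (\<lambda>n. of_nat (Suc n) powr (- s)) sums f s) \<and>
                  f 1 = 0)"

text \<open>
  In the strip \<open>0 < Re s < N\<close> single terms of the following sum are singular exactly at
  \<open>s = 1, \<dots>, N - 1\<close> (poles of zeta or zeros of the Pochhammer symbol). At those points the
  value of the formal sum is an artefact of \<open>zeta 1 = 0\<close> and \<open>x / 0 = 0\<close>, and only the
  limit is meaningful.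
\<close>

definition zeta_sum :: "nat \<Rightarrow> complex \<Rightarrow> complex" where
  "zeta_sum N s = fact N *
     (\<Sum>k=0..N-1. (-1) ^ k * zeta (s - of_nat k) / (fact (N - k) * pochhammer (- s) (k + 1)))"

end

theory Submission
  imports Defs
begin

text \<open>
  Put \<open>G\<^sub>N(s) = \<integral>\<^sub>1\<^sup>\<infinity> {y}\<^sup>N y\<^bsup>-s-1\<^esup> dy\<close> for \<open>Re s > 0\<close>. Integrating by parts on each unit interval
  gives \<open>(s+1) G\<^bsub>N+1\<^esub>(s+1) = (N+1) G\<^sub>N(s) - (\<zeta>(s+1) - 1)\<close>. Subtracting the case \<open>N = 0\<close>, where
  \<open>G\<^sub>0(s) = 1/s\<close>, eliminates \<open>\<zeta>\<close>, and \<open>A\<^sub>N(s) = s G\<^sub>N(s)\<close> satisfies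
  \<open>(N+1) A\<^sub>N(s) = s (A\<^bsub>N+1\<^esub>(s+1) - A\<^sub>1(s+1)) + 1\<close>. Read from right to left this extends every \<open>A\<^sub>N\<close>,
  one strip at a time, to an entire function, and with it \<open>\<zeta>(s) = 1 + 1/(s-1) - A\<^sub>1(s)\<close>.
  The integral over \<open>(0,\<infinity>)\<close> is \<open>F\<^sub>N(s) = A\<^sub>N(s)/s - 1/(s-N)\<close>, and the recurrence becomes
  \<open>s F\<^sub>N(s) = N F\<^bsub>N-1\<^esub>(s-1) - \<zeta>(s)\<close> for all complex \<open>s\<close>, which unfolds to the sum over \<open>k\<close>.
\<close>

section \<open>Integrals over unit intervals and their sum\<close>

text \<open>The interval is \<open>[n+1, n+2]\<close>. Writing \<open>y - (n+1)\<close> in place of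
  the fractional part changes the integrand at most at the right endpoint and makes it continuous on
  the closed interval.\<close>

definition frac_piece :: "nat \<Rightarrow> nat \<Rightarrow> complex \<Rightarrow> complex" where
  "frac_piece N n s = integral {real (Suc n)..real (Suc n) + 1}
     (\<lambda>y. (of_real y - of_nat (Suc n)) ^ N * of_real y powr (- s - 1))"

text \<open>This is \<open>G_N\<close>, taken as a series so that holomorphy follows from locally
  uniform convergence. Its identification with the integral over \<open>[1, \<infinity>)\<close>
  comes only later.\<close>

definition frac_tail :: "nat \<Rightarrow> complex \<Rightarrow> complex" where
  "frac_tail N s = (\<Sum>n. frac_piece N n s)"

lemma continuous_on_frac_piece_integrand:
  "continuous_on {real (Suc n)..real (Suc n) + 1}
     (\<lambda>y. (of_real y - of_nat (Suc n)) ^ N * complex_of_real y powr (- s - 1))"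
  by (intro continuous_intros) auto

lemma frac_piece_integrable:
  "(\<lambda>y. (of_real y - of_nat (Suc n)) ^ N * complex_of_real y powr (- s - 1))
     integrable_on {real (Suc n)..real (Suc n) + 1}"
  by (rule integrable_continuous_real, rule continuous_on_frac_piece_integrand)

text \<open>Keeping \<open>\<sigma>\<close> apart from \<open>Re s\<close> makes the bound uniform
  on a half-plane, as a majorant series requires.\<close>

lemma norm_frac_piece_le:
  assumes "0 \<le> \<sigma>" "\<sigma> \<le> Re s"
  shows "norm (frac_piece N n s) \<le> real (Suc n) powr (- \<sigma> - 1)"
proof -
  have "norm (frac_piece N n s) \<le> real (Suc n) powr (- \<sigma> - 1) * (real (Suc n) + 1 - real (Suc n))"
    unfolding frac_piece_def
  proof (rule integral_bound[OF _ continuous_on_frac_piece_integrand])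
    fix y assume y: "y \<in> {real (Suc n)..real (Suc n) + 1}"
    have "norm (complex_of_real y - of_nat (Suc n)) = \<bar>y - real (Suc n)\<bar>"
      by (metis norm_of_real of_real_diff of_real_of_nat_eq)
    also have "\<dots> \<le> 1" using y by simp
    finally have 1: "norm (complex_of_real y - of_nat (Suc n)) ^ N \<le> 1"
      by (simp add: power_le_one)
    have "norm (complex_of_real y powr (- s - 1)) = y powr (- Re s - 1)"
      using y by (simp add: norm_powr_real_powr)
    also have "\<dots> \<le> real (Suc n) powr (- Re s - 1)"
      using y assms by (intro powr_mono2') auto
    also have "\<dots> \<le> real (Suc n) powr (- \<sigma> - 1)"
      using assms by (intro powr_mono) auto
    finally have 2: "norm (complex_of_real y powr (- s - 1)) \<le> real (Suc n) powr (- \<sigma> - 1)" .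
    show "norm ((complex_of_real y - of_nat (Suc n)) ^ N * complex_of_real y powr (- s - 1))
        \<le> real (Suc n) powr (- \<sigma> - 1)"
      using mult_mono[OF 1 2] by (simp add: norm_mult norm_power)
  qed auto
  thus ?thesis by simp
qed

lemma summable_Suc_powr:
  "\<sigma> > 0 \<Longrightarrow> summable (\<lambda>n. real (Suc n) powr (- \<sigma> - 1))"
  by (simp only: summable_Suc_iff[of "\<lambda>n. real n powr (- \<sigma> - 1)"] summable_real_powr_iff)

lemma frac_piece_sums:
  assumes "Re s > 0"
  shows "(\<lambda>n. frac_piece N n s) sums frac_tail N s"
  unfolding frac_tail_def
proof (rule summable_sums, rule summable_comparison_test)
  show "\<exists>m. \<forall>n\<ge>m. norm (frac_piece N n s) \<le> real (Suc n) powr (- Re s - 1)"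
    using norm_frac_piece_le[of "Re s" s N] assms by auto
qed (use assms in \<open>rule summable_Suc_powr\<close>)

lemma holomorphic_frac_piece: "frac_piece N n holomorphic_on S"
proof (rule holomorphic_on_subset)
  have "(\<lambda>s. integral (cbox (real (Suc n)) (real (Suc n) + 1))
     (\<lambda>y. (of_real y - of_nat (Suc n)) ^ N * complex_of_real y powr (- s - 1))) holomorphic_on UNIV"
  proof (rule leibniz_rule_holomorphic)
    fix s :: complex and y :: real
    assume "y \<in> cbox (real (Suc n)) (real (Suc n) + 1)"
    hence "complex_of_real y \<noteq> 0" by auto
    hence "((\<lambda>s. complex_of_real y powr (- s - 1)) has_field_derivative
        (Ln (of_real y) * complex_of_real y powr (- s - 1)) * (- 1)) (at s)"
      by (intro DERIV_chain2[OF has_field_derivative_powr_right]) (auto intro!: derivative_eq_intros)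
    from DERIV_cmult[OF this, of "(of_real y - of_nat (Suc n)) ^ N"]
    show "((\<lambda>s. (of_real y - of_nat (Suc n)) ^ N * complex_of_real y powr (- s - 1))
      has_field_derivative (of_real y - of_nat (Suc n)) ^ N *
        (- (Ln (of_real y) * complex_of_real y powr (- s - 1)))) (at s within UNIV)"
      by simp
  next
    show "continuous_on (UNIV \<times> cbox (real (Suc n)) (real (Suc n) + 1))
       (\<lambda>(s, y). (of_real y - of_nat (Suc n)) ^ N *
        (- (Ln (of_real y) * complex_of_real y powr (- s - 1))))"
      unfolding split_beta by (intro continuous_intros) (auto simp: complex_nonpos_Reals_iff)
  qed (use frac_piece_integrable in auto)
  thus "frac_piece N n holomorphic_on UNIV"
    by (simp add: frac_piece_def[abs_def])
qed auto

lemma holomorphic_frac_tail: "frac_tail N holomorphic_on {s. Re s > 0}"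
proof (rule holomorphic_uniform_sequence)
  show "open {s. 0 < Re s}" by (rule open_halfspace_Re_gt)
  show "(\<lambda>s. \<Sum>i<n. frac_piece N i s) holomorphic_on {s. 0 < Re s}" for n
    by (intro holomorphic_intros holomorphic_frac_piece)
  fix s :: complex assume "s \<in> {s. 0 < Re s}"
  hence s: "Re s > 0" by simp
  \<comment> \<open>Radius \<open>Re s / 2\<close> keeps the ball inside
    \<open>Re z \<ge> d > 0\<close>, so one convergent majorant with exponent \<open>- d - 1\<close>
    serves the whole ball.\<close>
  define d where "d = Re s / 2"
  have d: "d > 0" using s by (simp add: d_def)
  have Re: "d \<le> Re z" if "z \<in> cball s d" for z
  proof -
    have "Re (s - z) \<le> d"
      using that complex_Re_le_cmod[of "s - z"] by (simp add: dist_norm)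
    thus ?thesis unfolding d_def by (simp add: field_simps)
  qed
  have "uniform_limit (cball s d) (\<lambda>n s. \<Sum>i<n. frac_piece N i s) (frac_tail N) sequentially"
    unfolding frac_tail_def[abs_def]
    by (rule Weierstrass_m_test[OF _ summable_Suc_powr[OF d]])
       (use Re d in \<open>auto intro!: norm_frac_piece_le simp del: of_nat_Suc\<close>)
  moreover have "cball s d \<subseteq> {s. 0 < Re s}" using Re d by force
  ultimately show "\<exists>d>0. cball s d \<subseteq> {s. 0 < Re s} \<and>
      uniform_limit (cball s d) (\<lambda>n s. \<Sum>i<n. frac_piece N i s) (frac_tail N) sequentially"
    using d by blast
qed

section \<open>Integration by parts and recurrences\<close>

text \<open>Integration by parts. The boundary term vanishes at \<open>n+1\<close> because the
  exponent \<open>Suc N\<close> is positive, and at \<open>n+2\<close> it is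
  \<open>(n+2) powr (- s - 1)\<close>, whatever \<open>N\<close> is.\<close>

lemma frac_piece_Suc:
  "(s + 1) * frac_piece (Suc N) n (s + 1) =
     of_nat (Suc N) * frac_piece N n s - of_nat (n + 2) powr (- s - 1)"
proof -
  let ?a = "real (Suc n)" and ?b = "real (Suc n) + 1"
  let ?g = "\<lambda>N s y. (of_real y - of_nat (Suc n)) ^ N * complex_of_real y powr (- s - 1)"
  let ?F = "\<lambda>z::complex. (z - of_nat (Suc n)) ^ Suc N * z powr (- s - 1)"
  have "((\<lambda>y. of_nat (Suc N) * ?g N s y - (s + 1) * ?g (Suc N) (s + 1) y) has_integral
      (?F (of_real ?b) - ?F (of_real ?a))) {?a..?b}"
  proof (rule fundamental_theorem_of_calculus)
    fix y assume "y \<in> {?a..?b}"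
    hence "complex_of_real y \<notin> \<real>\<^sub>\<le>\<^sub>0" by (auto simp: complex_nonpos_Reals_iff)
    hence "(?F has_field_derivative
        of_nat (Suc N) * (of_real y - of_nat (Suc n)) ^ N * of_real y powr (- s - 1) +
        (of_real y - of_nat (Suc n)) ^ Suc N * ((- s - 1) * of_real y powr (- s - 1 - 1)))
        (at (of_real y))"
      by (auto intro!: derivative_eq_intros has_field_derivative_powr simp del: of_nat_Suc power_Suc)
    from has_vector_derivative_real_field[OF this]
    show "((\<lambda>y. ?F (of_real y)) has_vector_derivative
        of_nat (Suc N) * ?g N s y - (s + 1) * ?g (Suc N) (s + 1) y) (at y within {?a..?b})"
      by (rule has_vector_derivative_eq_rhs) (simp add: algebra_simps)
  qed auto
  moreover have "((\<lambda>y. of_nat (Suc N) * ?g N s y - (s + 1) * ?g (Suc N) (s + 1) y) has_integral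
      (of_nat (Suc N) * frac_piece N n s - (s + 1) * frac_piece (Suc N) n (s + 1))) {?a..?b}"
    unfolding frac_piece_def
    by (intro has_integral_diff has_integral_mult_right integrable_integral frac_piece_integrable)
  ultimately have "of_nat (Suc N) * frac_piece N n s - (s + 1) * frac_piece (Suc N) n (s + 1) =
      ?F (of_real ?b) - ?F (of_real ?a)"
    by (rule has_integral_unique[rotated])
  thus ?thesis by (simp add: algebra_simps)
qed

lemma frac_piece_0:
  "s * frac_piece 0 n s = of_nat (Suc n) powr (- s) - of_nat (Suc (Suc n)) powr (- s)"
proof -
  let ?a = "real (Suc n)" and ?b = "real (Suc n) + 1"
  let ?F = "\<lambda>z::complex. - (z powr (- s))"
  have "((\<lambda>y. s * of_real y powr (- s - 1)) has_integral (?F (of_real ?b) - ?F (of_real ?a))) {?a..?b}"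
  proof (rule fundamental_theorem_of_calculus)
    fix y assume "y \<in> {?a..?b}"
    hence "complex_of_real y \<notin> \<real>\<^sub>\<le>\<^sub>0" by (auto simp: complex_nonpos_Reals_iff)
    hence "(?F has_field_derivative - ((- s) * of_real y powr (- s - 1))) (at (of_real y))"
      by (intro DERIV_minus has_field_derivative_powr)
    from has_vector_derivative_real_field[OF this]
    show "((\<lambda>y. ?F (of_real y)) has_vector_derivative s * of_real y powr (- s - 1))
      (at y within {?a..?b})" by simp
  qed auto
  moreover have "((\<lambda>y. s * of_real y powr (- s - 1)) has_integral s * frac_piece 0 n s) {?a..?b}"
    using has_integral_mult_right[OF integrable_integral[OF frac_piece_integrable[of n 0 s]], of s]
    by (simp add: frac_piece_def)
  ultimately have "s * frac_piece 0 n s = ?F (of_real ?b) - ?F (of_real ?a)"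
    by (rule has_integral_unique[rotated])
  thus ?thesis by (simp add: algebra_simps)
qed

lemma frac_tail_0:
  assumes "Re s > 0"
  shows "s * frac_tail 0 s = 1"
proof -
  have "(\<lambda>n. of_nat (Suc n) powr (- s)) \<longlonglongrightarrow> (0::complex)"
    using assms by (intro tendsto_neg_powr_complex_of_nat filterlim_Suc) auto
  from telescope_sums'[OF this] have "(\<lambda>n. s * frac_piece 0 n s) sums 1"
    by (simp add: frac_piece_0 del: of_nat_Suc) simp
  with sums_mult[OF frac_piece_sums[OF assms, of 0], of s] show ?thesis
    by (rule sums_unique2)
qed

text \<open>The boundary terms do not depend on \<open>N\<close>, so subtracting the recurrence for
  \<open>N = 0\<close> cancels them. The continuation built on this relation therefore presupposes
  nothing about zeta.\<close>

lemma frac_tail_Suc_diff: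
  assumes "Re s > 0"
  shows "(s + 1) * (frac_tail (Suc N) (s + 1) - frac_tail 1 (s + 1)) =
    of_nat (Suc N) * frac_tail N s - frac_tail 0 s"
proof -
  have s1: "Re (s + 1) > 0" using assms by simp
  have eq: "(s + 1) * (frac_piece (Suc N) n (s + 1) - frac_piece 1 n (s + 1)) =
      of_nat (Suc N) * frac_piece N n s - frac_piece 0 n s" for n
    using frac_piece_Suc[of s N n] frac_piece_Suc[of s 0 n]
    by (simp add: ring_distribs del: of_nat_Suc)
  have "(\<lambda>n. (s + 1) * (frac_piece (Suc N) n (s + 1) - frac_piece 1 n (s + 1))) sums
      ((s + 1) * (frac_tail (Suc N) (s + 1) - frac_tail 1 (s + 1)))"
    by (intro sums_mult sums_diff frac_piece_sums s1)
  moreover have "(\<lambda>n. (s + 1) * (frac_piece (Suc N) n (s + 1) - frac_piece 1 n (s + 1))) sums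
      (of_nat (Suc N) * frac_tail N s - frac_tail 0 s)"
    unfolding eq by (intro sums_mult sums_diff frac_piece_sums assms)
  ultimately show ?thesis by (rule sums_unique2)
qed

text \<open>Here the recurrence for \<open>N = 0\<close>, taken at \<open>s - 1\<close>, is solved
  for its boundary terms: they form the Dirichlet series without its first term 1.\<close>

lemma dirichlet_sums_frac_tail:
  assumes "Re s > 1"
  shows "(\<lambda>n. of_nat (Suc n) powr (- s)) sums (1 + 1 / (s - 1) - s * frac_tail 1 s)"
proof -
  have s1: "Re (s - 1) > 0" and s: "Re s > 0" using assms by auto
  have eq: "frac_piece 0 n (s - 1) - s * frac_piece 1 n s = of_nat (Suc (Suc n)) powr (- s)" for n
    using frac_piece_Suc[of "s - 1" 0 n] by simp
  have "(\<lambda>n. frac_piece 0 n (s - 1) - s * frac_piece 1 n s) sums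
      (frac_tail 0 (s - 1) - s * frac_tail 1 s)"
    by (intro sums_mult sums_diff frac_piece_sums s s1)
  also have "frac_tail 0 (s - 1) = 1 / (s - 1)"
    using frac_tail_0[OF s1] by (metis mult_zero_left nonzero_mult_div_cancel_left zero_neq_one)
  finally have "(\<lambda>n. of_nat (Suc (Suc n)) powr (- s)) sums (1 / (s - 1) - s * frac_tail 1 s)"
    unfolding eq .
  thus ?thesis
    by (subst (asm) sums_Suc_iff) (simp add: algebra_simps)
qed

section \<open>Continuation to entire functions\<close>

text \<open>
  \<open>tail_ext M N\<close> continues \<open>s * frac_tail N s\<close> to \<open>Re s > - M\<close>.
\<close>

primrec tail_ext :: "nat \<Rightarrow> nat \<Rightarrow> complex \<Rightarrow> complex" where
  "tail_ext 0 N s = s * frac_tail N s"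
| "tail_ext (Suc M) N s =
     (s * (tail_ext M (Suc N) (s + 1) - tail_ext M 1 (s + 1)) + 1) / of_nat (Suc N)"

lemma holomorphic_tail_ext: "tail_ext M N holomorphic_on {s. Re s > - real M}"
proof (induction M arbitrary: N)
  case 0
  have "(\<lambda>s. s * frac_tail N s) holomorphic_on {s. Re s > 0}"
    by (intro holomorphic_intros holomorphic_frac_tail)
  thus ?case by simp
next
  case (Suc M)
  have shift: "(\<lambda>s. tail_ext M K (s + 1)) holomorphic_on {s. Re s > - real (Suc M)}" for K
    by (rule holomorphic_on_compose_gen[OF _ Suc.IH[of K], of "\<lambda>s. s + 1", unfolded o_def])
       (auto intro!: holomorphic_intros)
  have "(\<lambda>s. (s * (tail_ext M (Suc N) (s + 1) - tail_ext M 1 (s + 1)) + 1) / of_nat (Suc N))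
      holomorphic_on {s. Re s > - real (Suc M)}"
    by (intro holomorphic_intros shift) auto
  thus ?case by simp
qed

text \<open>Analysis enters only at \<open>M = 0\<close>: there the recursion is
  \<open>frac_tail_Suc_diff\<close> multiplied by \<open>s\<close>, and
  \<open>s * frac_tail 0 s = 1\<close> cancels the summand 1. Later stages inherit the agreement
  from \<open>s + 1\<close>.\<close>

lemma tail_ext_Suc_eq: "Re s > - real M \<Longrightarrow> tail_ext (Suc M) N s = tail_ext M N s"
proof (induction M arbitrary: N s)
  case 0
  have "tail_ext (Suc 0) N s =
      (s * ((s + 1) * (frac_tail (Suc N) (s + 1) - frac_tail 1 (s + 1))) + 1) / of_nat (Suc N)"
    by (simp add: algebra_simps)
  also have "\<dots> = (of_nat (Suc N) * (s * frac_tail N s) - s * frac_tail 0 s + 1) / of_nat (Suc N)"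
    using 0 by (subst frac_tail_Suc_diff) (simp_all add: algebra_simps)
  also have "\<dots> = s * frac_tail N s"
    using 0 by (subst frac_tail_0) (simp_all del: of_nat_Suc)
  finally show ?case by simp
next
  case (Suc M)
  have "tail_ext (Suc M) K (s + 1) = tail_ext M K (s + 1)" for K
    by (rule Suc.IH) (use Suc.prems in auto)
  thus ?case by (simp only: tail_ext.simps(2)[of "Suc M"] tail_ext.simps(2)[of M N s])
qed

lemma tail_ext_mono:
  assumes "M \<le> M'" "Re s > - real M"
  shows "tail_ext M' N s = tail_ext M N s"
  using assms by (induction M' rule: dec_induct) (simp_all add: tail_ext_Suc_eq del: tail_ext.simps)

text \<open>The stage is chosen pointwise from \<open>s\<close>. The additional \<open>Suc\<close>
  makes \<open>Re s > - M\<close> strict, so that \<open>s\<close> lies in the open half-plane of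
  that stage.\<close>

definition frac_tail_entire :: "nat \<Rightarrow> complex \<Rightarrow> complex" where
  "frac_tail_entire N s = tail_ext (Suc (nat \<lceil>- Re s\<rceil>)) N s"

lemma frac_tail_entire_eq:
  assumes "Re s > - real M"
  shows "frac_tail_entire N s = tail_ext M N s"
proof -
  define K where "K = Suc (nat \<lceil>- Re s\<rceil>)"
  have "Re s > - real K" unfolding K_def by linarith
  with assms have "tail_ext (max M K) N s = tail_ext M N s" "tail_ext (max M K) N s = tail_ext K N s"
    by (auto intro!: tail_ext_mono)
  thus ?thesis by (simp add: frac_tail_entire_def K_def)
qed

lemma holomorphic_frac_tail_entire: "frac_tail_entire N holomorphic_on S"
proof (rule holomorphic_on_subset)
  show "frac_tail_entire N holomorphic_on (\<Union>M. {s. Re s > - real M})"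
  proof (rule holomorphic_on_UN_open)
    show "frac_tail_entire N holomorphic_on {s. Re s > - real M}" for M
      by (rule holomorphic_transform[OF holomorphic_tail_ext[of M N]]) (simp add: frac_tail_entire_eq)
  qed (rule open_halfspace_Re_gt)
  have "\<exists>M. - real M < Re s" for s
    using reals_Archimedean2[of "- Re s"] by (auto simp: minus_less_iff)
  thus "S \<subseteq> (\<Union>M. {s. Re s > - real M})" by auto
qed

lemma frac_tail_entire_pos: "Re s > 0 \<Longrightarrow> frac_tail_entire N s = s * frac_tail N s"
  using frac_tail_entire_eq[of 0] by simp

text \<open>One \<open>M\<close> with \<open>- M < Re s\<close> serves both points: stage
  \<open>Suc M\<close> at \<open>s\<close> and stage \<open>M\<close> at \<open>s + 1\<close>, which
  is exactly one unfolding of \<open>tail_ext\<close>.\<close>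

lemma frac_tail_entire_rec:
  "of_nat (Suc N) * frac_tail_entire N s =
     s * (frac_tail_entire (Suc N) (s + 1) - frac_tail_entire 1 (s + 1)) + 1"
proof -
  obtain M where M: "- real M < Re s"
    using reals_Archimedean2[of "- Re s"] by (auto simp: minus_less_iff)
  have "frac_tail_entire N s = tail_ext (Suc M) N s"
    by (rule frac_tail_entire_eq) (use M in auto)
  moreover have "frac_tail_entire K (s + 1) = tail_ext M K (s + 1)" for K
    by (rule frac_tail_entire_eq) (use M in auto)
  ultimately show ?thesis by (simp del: of_nat_Suc)
qed

section \<open>Zeta and the closed form of the finite sum\<close>

text \<open>The right-hand side meets the three defining conditions. Any other candidate agrees with
  it on \<open>Re s > 1\<close>, hence on the connected punctured plane by the identity theorem, and
  at 1 by the prescribed value.\<close>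

lemma zeta_eq: "zeta s = (if s = 1 then 0 else 1 + 1 / (s - 1) - frac_tail_entire 1 s)"
proof -
  define Z where "Z = (\<lambda>s. if s = 1 then 0 else 1 + 1 / (s - 1) - frac_tail_entire 1 s)"
  have "(\<lambda>s. 1 + 1 / (s - 1) - frac_tail_entire 1 s) holomorphic_on - {1}"
    by (intro holomorphic_intros holomorphic_frac_tail_entire) auto
  hence hol: "Z holomorphic_on - {1}"
    by (rule holomorphic_transform) (simp add: Z_def)
  have sums: "(\<lambda>n. of_nat (Suc n) powr (- s)) sums Z s" if "Re s > 1" for s
    using dirichlet_sums_frac_tail[OF that] that
    by (auto simp: Z_def frac_tail_entire_pos simp del: of_nat_Suc)
  have zeta: "zeta = Z"
    unfolding zeta_def
  proof (rule the_equality)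
    show "Z holomorphic_on - {1} \<and>
        (\<forall>s. Re s > 1 \<longrightarrow> (\<lambda>n. of_nat (Suc n) powr (- s)) sums Z s) \<and> Z 1 = 0"
      using hol sums by (simp add: Z_def)
  next
    fix f :: "complex \<Rightarrow> complex"
    assume f: "f holomorphic_on - {1} \<and>
        (\<forall>s. Re s > 1 \<longrightarrow> (\<lambda>n. of_nat (Suc n) powr (- s)) sums f s) \<and> f 1 = 0"
    show "f = Z"
    proof
      fix s
      show "f s = Z s"
      proof (cases "s = 1")
        case False
        show ?thesis
        proof (rule analytic_continuation_open[of "{s. Re s > 1}" "- {1}" f Z])
          have "2 \<in> {s. Re s > 1}" by simp
          thus "{s. Re s > 1} \<noteq> {}" by blast
          show "connected (- {1::complex})" by (rule connected_punctured_universe) simp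
          show "f z = Z z" if "z \<in> {s. Re s > 1}" for z
            using f sums[of z] that by (auto intro: sums_unique2)
        qed (use f hol False open_halfspace_Re_gt in auto)
      qed (use f in \<open>simp add: Z_def\<close>)
    qed
  qed
  show ?thesis unfolding zeta Z_def ..
qed

text \<open>Split off \<open>k = 0\<close> and shift the rest, using
  \<open>(-s)_{k+2} = -s (1-s)_{k+1}\<close>; the sign is absorbed by \<open>(-1)^(k+1)\<close>. At
  \<open>s = 0\<close> both sides are 0 through division by zero.\<close>

lemma zeta_sum_Suc_Suc:
  "zeta_sum (Suc (Suc N)) s = (of_nat (Suc (Suc N)) * zeta_sum (Suc N) (s - 1) - zeta s) / s"
proof -
  let ?t = "\<lambda>k. (-1) ^ k * zeta (s - of_nat k) / (fact (Suc (Suc N) - k) * pochhammer (- s) (k + 1))"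
  have shift: "?t (Suc k) = (-1) ^ k * zeta (s - 1 - of_nat k) /
      (fact (Suc N - k) * pochhammer (- (s - 1)) (k + 1)) / s" for k
  proof -
    have "pochhammer (- s) (Suc k + 1) = - s * pochhammer (- (s - 1)) (k + 1)"
      by (simp only: Suc_eq_plus1[symmetric] pochhammer_rec[of "- s"]) simp
    thus ?thesis by (simp add: algebra_simps)
  qed
  have "zeta_sum (Suc (Suc N)) s = fact (Suc (Suc N)) * (\<Sum>k=0..Suc N. ?t k)"
    unfolding zeta_sum_def by simp
  also have "(\<Sum>k=0..Suc N. ?t k) = ?t 0 + (\<Sum>k=0..N. ?t (Suc k))"
    by (rule sum.atLeast0_atMost_Suc_shift[unfolded o_def])
  also have "(\<Sum>k=0..N. ?t (Suc k)) = zeta_sum (Suc N) (s - 1) / fact (Suc N) / s"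
    unfolding shift zeta_sum_def by (simp add: sum_divide_distrib del: fact_Suc)
  also have "?t 0 = - (zeta s / (fact (Suc (Suc N)) * s))"
    by (simp del: fact_Suc)
  also have "fact (Suc (Suc N)) * (- (zeta s / (fact (Suc (Suc N)) * s)) +
      zeta_sum (Suc N) (s - 1) / fact (Suc N) / s) =
      (of_nat (Suc (Suc N)) * zeta_sum (Suc N) (s - 1) - zeta s) / s"
    by (cases "s = 0") (simp_all add: field_simps fact_Suc[of "Suc N"] del: fact_Suc of_nat_Suc)
  finally show ?thesis .
qed

text \<open>Induction lowers \<open>N\<close> and \<open>s\<close> together. The excluded integers
  are those where a Pochhammer factor vanishes or zeta would be taken at 1. The right-hand side
  stays regular at \<open>1, ..., N\<close>, which later yields the limits there.\<close>

lemma zeta_sum_eq: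
  assumes "s \<notin> of_nat ` {..Suc N}"
  shows "zeta_sum (Suc N) s = frac_tail_entire (Suc N) s / s - 1 / (s - of_nat (Suc N))"
  using assms
proof (induction N arbitrary: s)
  case 0
  hence "s \<noteq> 0" "s \<noteq> 1" by (auto simp: image_iff)
  thus ?case by (simp add: zeta_sum_def zeta_eq field_simps)
next
  case (Suc N)
  define K where "K = (of_nat (Suc (Suc N)) :: complex)"
  have "s \<noteq> of_nat k" if "k \<le> Suc (Suc N)" for k using Suc.prems that by auto
  from this[of 0] this[of 1] this[of "Suc (Suc N)"]
  have s: "s \<noteq> 0" "s - 1 \<noteq> 0" "s - K \<noteq> 0" by (auto simp: K_def)
  have "s - 1 \<notin> of_nat ` {..Suc N}"
  proof
    assume "s - 1 \<in> of_nat ` {..Suc N}"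
    then obtain k where "k \<le> Suc N" "s - 1 = of_nat k" by auto
    hence "s = of_nat (Suc k)" "Suc k \<le> Suc (Suc N)" by (auto simp: algebra_simps)
    thus False using Suc.prems by blast
  qed
  from Suc.IH[OF this] have IH: "zeta_sum (Suc N) (s - 1) =
      frac_tail_entire (Suc N) (s - 1) / (s - 1) - 1 / (s - K)"
    by (simp add: K_def algebra_simps)
  have "K * zeta_sum (Suc N) (s - 1) = K * frac_tail_entire (Suc N) (s - 1) / (s - 1) - K / (s - K)"
    unfolding IH by (simp add: algebra_simps)
  also have "K * frac_tail_entire (Suc N) (s - 1) =
      (s - 1) * (frac_tail_entire (Suc (Suc N)) s - frac_tail_entire 1 s) + 1"
    using frac_tail_entire_rec[of "Suc N" "s - 1"] by (simp add: K_def)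
  also have "\<dots> / (s - 1) = frac_tail_entire (Suc (Suc N)) s - frac_tail_entire 1 s + 1 / (s - 1)"
    using s by (simp add: add_divide_distrib)
  \<comment> \<open>Subtracting \<open>zeta s = 1 + 1/(s-1) - A_1(s)\<close> removes both
    \<open>A_1(s)\<close> and \<open>1/(s-1)\<close>.\<close>
  finally have "K * zeta_sum (Suc N) (s - 1) - zeta s = frac_tail_entire (Suc (Suc N)) s - 1 - K / (s - K)"
    using s by (simp add: zeta_eq)
  also have "\<dots> = frac_tail_entire (Suc (Suc N)) s - s / (s - K)"
    using s by (simp add: field_simps)
  finally show ?case
    unfolding zeta_sum_Suc_Suc K_def[symmetric] using s by (simp add: diff_divide_distrib)
qed

section \<open>The integral over the positive half-line\<close>

lemma frac_powr_measurable [measurable]: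
  "(\<lambda>y::real. complex_of_real (frac y ^ N) * of_real y powr (- s - 1)) \<in> borel_measurable borel"
  unfolding frac_def by measurable

text \<open>Domination by a real power. That power is nonnegative, so its gauge integrability is
  absolute and hence Lebesgue; \<open>A\<close> lies in the positive reals, where the norm of the
  complex power is a real power.\<close>

lemma frac_powr_set_integrable_bound:
  assumes "(\<lambda>y. y powr e) integrable_on A" "A \<in> sets borel" "A \<subseteq> {0<..}"
    and "\<And>y. y \<in> A \<Longrightarrow> frac y ^ N * y powr (- Re s - 1) \<le> y powr e"
  shows "set_integrable lborel A
    (\<lambda>y::real. complex_of_real (frac y ^ N) * of_real y powr (- s - 1))"
proof (rule set_integrable_bound)
  have "set_integrable lebesgue A (\<lambda>y. y powr e)"
    using assms by (subst absolutely_integrable_on_iff_nonneg) auto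
  thus "set_integrable lborel A (\<lambda>y. y powr e)"
    unfolding set_integrable_def using assms(2) by (subst (asm) integrable_completion) auto
  show "set_borel_measurable lborel A
      (\<lambda>y::real. complex_of_real (frac y ^ N) * of_real y powr (- s - 1))"
    unfolding set_borel_measurable_def using assms(2) by measurable
  have "norm (complex_of_real (frac y ^ N) * of_real y powr (- s - 1)) \<le> norm (y powr e)"
    if "y \<in> A" for y
    using assms(4)[OF that] that assms(3)
    by (auto simp: norm_mult norm_powr_real_powr norm_power subset_eq simp flip: of_real_power)
  thus "AE y in lborel. y \<in> A \<longrightarrow>
      norm (complex_of_real (frac y ^ N) * of_real y powr (- s - 1)) \<le> norm (y powr e)"
    by simp
qed

lemma frac_powr_integrable_atLeast_1:
  assumes "Re s > 0"
  shows "set_integrable lborel {1..}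
    (\<lambda>y::real. complex_of_real (frac y ^ N) * of_real y powr (- s - 1))"
proof (rule frac_powr_set_integrable_bound)
  show "(\<lambda>y. y powr (- Re s - 1)) integrable_on {1..}"
    using has_integral_powr_to_inf[of "- Re s - 1" 1] assms by (auto simp: integrable_on_def)
  show "frac y ^ N * y powr (- Re s - 1) \<le> y powr (- Re s - 1)" for y
    by (intro mult_left_le_one_le power_le_one) (auto simp: frac_lt_1 less_imp_le)
qed auto

lemma frac_powr_integral_atLeast_1:
  assumes "Re s > 0"
  shows "(LINT y:{1..}|lborel. complex_of_real (frac y ^ N) * of_real y powr (- s - 1)) =
    frac_tail N s"
proof -
  let ?f = "\<lambda>y::real. complex_of_real (frac y ^ N) * of_real y powr (- s - 1)"
  \<comment> \<open>Half-open intervals partition \<open>[1, \<infinity>)\<close>, with the floor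
    constant on each. They differ from the intervals of \<open>frac_piece\<close> only in one
    endpoint, a null set.\<close>
  define A where "A = (\<lambda>n. {real (Suc n)..<real (Suc n) + 1})"
  have floor: "\<lfloor>y\<rfloor> = int (Suc n)" if "y \<in> A n" for y n
    using that by (auto simp: A_def floor_eq_iff)
  have Un: "(\<Union>n. A n) = {1..}"
  proof (intro equalityI subsetI)
    fix y :: real assume y: "y \<in> {1..}"
    hence "\<lfloor>y\<rfloor> \<ge> 1" by simp
    hence "real (Suc (nat (\<lfloor>y\<rfloor> - 1))) = of_int \<lfloor>y\<rfloor>" by simp
    hence "y \<in> A (nat (\<lfloor>y\<rfloor> - 1))" unfolding A_def by (simp del: of_nat_Suc)
    thus "y \<in> (\<Union>n. A n)" by blast
  qed (auto simp: A_def)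
  have int: "set_integrable lborel {1..} ?f" by (rule frac_powr_integrable_atLeast_1[OF assms])
  have piece: "(LINT y:A n|lborel. ?f y) = frac_piece N n s" for n
  proof -
    have "A n \<subseteq> {1..}" using Un by blast
    hence "set_integrable lborel (A n) ?f"
      by (intro set_integrable_subset[OF int]) (auto simp: A_def)
    hence "(LINT y:A n|lborel. ?f y) = integral (A n) ?f"
      by (rule set_borel_integral_eq_integral)
    also have "\<dots> = integral (A n) (\<lambda>y. (of_real y - of_nat (Suc n)) ^ N * of_real y powr (- s - 1))"
      by (intro integral_cong) (simp add: floor frac_def)
    also have "\<dots> = frac_piece N n s"
      unfolding frac_piece_def
      by (rule integral_subset_negligible)
         (auto simp: A_def intro!: negligible_subset[OF negligible_sing[of "real (Suc n) + 1"]])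
    finally show ?thesis .
  qed
  have "(LINT y:{1..}|lborel. ?f y) = (\<Sum>n. LINT y:A n|lborel. ?f y)"
    unfolding Un[symmetric]
  proof (rule lebesgue_integral_countable_add)
    show "A i \<inter> A j = {}" if "i \<noteq> j" for i j
    proof (rule ccontr)
      assume "A i \<inter> A j \<noteq> {}"
      then obtain y where "y \<in> A i" "y \<in> A j" by blast
      with floor[of y i] floor[of y j] that show False by simp
    qed
    show "set_integrable lborel (\<Union>n. A n) ?f" unfolding Un by (rule int)
  qed (simp add: A_def)
  thus ?thesis by (simp only: piece frac_tail_def)
qed

text \<open>On \<open>(0, 1)\<close> the fractional part is \<open>y\<close> itself, so the
  integrand is \<open>y powr (z - 1)\<close> with \<open>z = N - s\<close>.\<close>

lemma frac_powr_unit_interval: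
  assumes "Re s < real N"
  shows "set_integrable lborel {0<..<1}
      (\<lambda>y::real. complex_of_real (frac y ^ N) * of_real y powr (- s - 1))"
    and "(LINT y:{0<..<1}|lborel. complex_of_real (frac y ^ N) * of_real y powr (- s - 1)) =
      1 / (of_nat N - s)"
proof -
  let ?f = "\<lambda>y::real. complex_of_real (frac y ^ N) * of_real y powr (- s - 1)"
  define z where "z = of_nat N - s"
  have z: "Re z > 0" "z \<noteq> 0" using assms by (auto simp: z_def)
  show *: "set_integrable lborel {0<..<1} ?f"
  proof (rule frac_powr_set_integrable_bound)
    show "(\<lambda>y. y powr (Re z - 1)) integrable_on {0<..<1}"
      using integrable_on_powr_from_0[of "Re z - 1" 1] z
      by (simp add: integrable_on_Icc_iff_Ioo)
    show "frac y ^ N * y powr (- Re s - 1) \<le> y powr (Re z - 1)" if "y \<in> {0<..<1}" for y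
      using that by (simp add: frac_eq[THEN iffD2] z_def powr_diff powr_minus powr_realpow powr_add field_simps)
  qed auto
  \<comment> \<open>The antiderivative \<open>t powr z / z\<close> is needed as differentiable only
    in the interior; \<open>Re z > 0\<close> makes it continuous at 0, with value 0.\<close>
  have "((\<lambda>t. complex_of_real t powr (z - 1)) has_integral
      (of_real 1 powr z / z - of_real 0 powr z / z)) {0..1}"
    using z by (intro fundamental_theorem_of_calculus_interior)
      (auto intro!: continuous_intros derivative_eq_intros has_vector_derivative_real_field)
  hence I: "integral {0<..<1} (\<lambda>t. complex_of_real t powr (z - 1)) = 1 / z"
    by (simp add: has_integral_Icc_iff_Ioo integral_unique)
  have "(LINT y:{0<..<1}|lborel. ?f y) = integral {0<..<1} ?f"
    by (rule set_borel_integral_eq_integral(2)[OF *])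
  also have "\<dots> = integral {0<..<1} (\<lambda>t. complex_of_real t powr (z - 1))"
    by (intro integral_cong)
       (auto simp: frac_eq[THEN iffD2] z_def powr_diff powr_minus powr_add field_simps)
  finally show "(LINT y:{0<..<1}|lborel. ?f y) = 1 / (of_nat N - s)"
    using I by (simp add: z_def)
qed

lemma frac_powr_integral:
  assumes "0 < Re s" "Re s < real N"
  shows "set_integrable lborel {0<..}
      (\<lambda>y::real. complex_of_real (frac y ^ N) * of_real y powr (- s - 1))"
    and "(LINT y:{0<..}|lborel. complex_of_real (frac y ^ N) * of_real y powr (- s - 1)) =
      frac_tail_entire N s / s - 1 / (s - of_nat N)"
proof -
  have Un: "{0<..} = {0<..<1} \<union> {1::real..}" by auto
  note int = frac_powr_unit_interval(1)[OF assms(2)] frac_powr_integrable_atLeast_1[OF assms(1)]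
  show "set_integrable lborel {0<..}
      (\<lambda>y::real. complex_of_real (frac y ^ N) * of_real y powr (- s - 1))"
    unfolding Un by (rule set_integrable_Un[OF int]) auto
  have "s \<noteq> 0" using assms by auto
  hence "frac_tail N s = frac_tail_entire N s / s"
    using assms by (simp add: frac_tail_entire_pos)
  moreover have "1 / (of_nat N - s) = - (1 / (s - of_nat N))"
    by (metis minus_diff_eq minus_divide_right)
  ultimately show "(LINT y:{0<..}|lborel. complex_of_real (frac y ^ N) * of_real y powr (- s - 1)) =
      frac_tail_entire N s / s - 1 / (s - of_nat N)"
    unfolding Un
    by (subst set_integral_Un[OF _ int])
       (auto simp: frac_powr_unit_interval(2) frac_powr_integral_atLeast_1 assms simp del: of_real_power)
qed

section \<open>The identity in the strip and its limit form at integers\<close>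

theorem theorem1p2:
  fixes N :: nat and s :: complex
  assumes "N \<ge> 1" and "0 < Re s" and "Re s < real N"
  shows "set_integrable lborel {0<..}
           (\<lambda>y::real. of_real (frac y ^ N) * of_real y powr (- s - 1)) \<and>
         (s \<notin> of_nat ` {1..<N} \<longrightarrow>
           (LINT y:{0<..}|lborel. of_real (frac y ^ N) * of_real y powr (- s - 1)) = zeta_sum N s) \<and>
         (s \<in> of_nat ` {1..<N} \<longrightarrow>
           (zeta_sum N \<longlongrightarrow>
             (LINT y:{0<..}|lborel. of_real (frac y ^ N) * of_real y powr (- s - 1))) (at s))"
proof (intro conjI impI)
  \<comment> \<open>\<open>F\<close> is the common closed form of integral and sum. It is continuous
    throughout the strip, also at the integers where single terms of the sum are singular.\<close>
  define F where "F = (\<lambda>s. frac_tail_entire N s / s - 1 / (s - of_nat N))"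
  have zeta_sum: "zeta_sum N w = F w" if "w \<notin> of_nat ` {..N}" for w
    using zeta_sum_eq[of w "N - 1"] that assms(1) by (simp add: F_def)
  show "set_integrable lborel {0<..} (\<lambda>y::real. of_real (frac y ^ N) * of_real y powr (- s - 1))"
    by (rule frac_powr_integral(1)) fact+
  have eq: "(LINT y:{0<..}|lborel. of_real (frac y ^ N) * of_real y powr (- s - 1)) = F s"
    unfolding F_def by (rule frac_powr_integral(2)) fact+
  show "(LINT y:{0<..}|lborel. of_real (frac y ^ N) * of_real y powr (- s - 1)) = zeta_sum N s"
    if "s \<notin> of_nat ` {1..<N}"
  proof -
    \<comment> \<open>The bounds on \<open>Re s\<close> rule out the remaining two integers, 0 and
      \<open>N\<close>.\<close>
    have "s \<notin> of_nat ` {..N}"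
    proof
      assume "s \<in> of_nat ` {..N}"
      then obtain k where "s = of_nat k" by auto
      with assms(2,3) that show False by auto
    qed
    thus ?thesis by (simp only: eq zeta_sum not_False_eq_True)
  qed
  show "(zeta_sum N \<longlongrightarrow>
      (LINT y:{0<..}|lborel. of_real (frac y ^ N) * of_real y powr (- s - 1))) (at s)"
    unfolding eq
  proof (rule Lim_transform_eventually)
    have "isCont (frac_tail_entire N) s"
      using holomorphic_on_imp_continuous_on[OF holomorphic_frac_tail_entire[of N UNIV]]
      by (simp add: continuous_on_eq_continuous_at)
    moreover have "s \<noteq> 0" "s - of_nat N \<noteq> 0" using assms by auto
    ultimately have "isCont F s" unfolding F_def by (intro continuous_intros) auto
    thus "(F \<longlongrightarrow> F s) (at s)" by (simp add: isCont_def)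
    \<comment> \<open>Only finitely many integers are exceptional, so near \<open>s\<close> the sole
      possible exception is \<open>s\<close> itself, which the punctured limit ignores.\<close>
    have "eventually (\<lambda>w. w \<in> - (of_nat ` {..N} - {s})) (nhds s)"
      by (intro eventually_nhds_in_open open_Compl finite_imp_closed) auto
    thus "eventually (\<lambda>w. F w = zeta_sum N w) (at s)"
      unfolding eventually_at_filter by eventually_elim (auto simp: zeta_sum)
  qed
qed

end
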